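(* (Energy stability of the characteristic interface treatment.) Consider an interface between two blocks with sides $f^{-}$ and $f^{+}$ sharing the same face grid points. For each side let the energy face rate of change be $$\dot{\mathcal{E}}^{f^\pm}=(\hat{\boldsymbol{\tau}}^{*f^\pm})^T\boldsymbol{H}^f\dot{\boldsymbol{u}}^{f^\pm}+(\hat{\boldsymbol{\tau}}^{f^\pm})^T\boldsymbol{H}^f\big(\dot{\boldsymbol{u}}^{*f^\pm}-\dot{\boldsymbol{u}}^{f^\pm}\big).$$ Let the numerical fluxes be $$\dot{\boldsymbol{u}}^{*f^\pm}=\tfrac12(\hat{\boldsymbol{Z}}^{f^\pm})^{-1}\big(\hat{\boldsymbol{q}}^{*f^\pm}+\hat{\boldsymbol{w}}^{*f^\pm}\big),\qquad \hat{\boldsymbol{\tau}}^{*f^\pm}=\tfrac12\big(\hat{\boldsymbol{q}}^{*f^\pm}-\hat{\boldsymbol{w}}^{*f^\pm}\big),$$ $$\hat{\boldsymbol{w}}^{*f^\pm}=\hat{\boldsymbol{Z}}^{f^\pm}\dot{\boldsymbol{u}}^{f^\pm}-\hat{\boldsymbol{\tau}}^{f^\pm},\qquad \hat{\boldsymbol{q}}^{*f^\pm}=\hat{\mathcal{Q}}^{f^\pm}\big(\hat{\boldsymbol{w}}^{*f^\pm},\hat{\boldsymbol{w}}^{*f^\mp}\big),$$ where $\hat{\mathcal{Q}}^{f^\pm}$, applied pointwise, are the functions associated either with a computational interface or with a nonlinear interface. Put $\boldsymbol{V}^{*f^\pm}=\dot{\boldsymbol{u}}^{*f^\mp}-\dot{\boldsymbol{u}}^{*f^\pm}$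 and $\hat{\boldsymbol{q}}^{f^\pm}=\hat{\boldsymbol{Z}}^{f^\pm}\dot{\boldsymbol{u}}^{f^\pm}+\hat{\boldsymbol{\tau}}^{f^\pm}$. Then $$\dot{\mathcal{E}}^{f^-}+\dot{\mathcal{E}}^{f^+}=-(\hat{\boldsymbol{\tau}}^{*f^-})^T\boldsymbol{H}^f\boldsymbol{V}^{*f^-}-\frac14\sum_{s\in\{-,+\}}\big(\hat{\boldsymbol{q}}^{*f^s}-\hat{\boldsymbol{q}}^{f^s}\big)^T(\hat{\boldsymbol{Z}}^{f^s})^{-1}\boldsymbol{H}^f\big(\hat{\boldsymbol{q}}^{*f^s}-\hat{\boldsymbol{q}}^{f^s}\big),$$ and this quantity is $\le 0$.
   Context: $\boldsymbol{H}^f$ is the diagonal, positive surface quadrature (norm) matrix of the common face; $\hat{\boldsymbol{Z}}^{f^\pm}$ is the diagonal matrix of the positive shear impedances $\hat Z^{f^\pm}$ on each side at the face grid points. $\dot{\boldsymbol{u}}^{f^\pm}$ is the grid particle velocity restricted to the face on each side and $\hat{\boldsymbol{\tau}}^{f^\pm}$ the penalized grid traction on each side; $\boldsymbol{u}^{*f^\pm}$ is an additional face unknown whose time derivative is the given $\dot{\boldsymbol{u}}^{*f^\pm}$. Definition of $\hat{\mathcal{Q}}^{f^\pm}$ at a face point (scalar arguments $\hat w^\pm$): (a) Computational interface: $\hat{\mathcal{Q}}^{f^\pm}(\hat w^{\pm},\hat w^{\mp})=\dfrac{2\hat Z^{f^\pm}\hat w^{\mp}+(\hat Z^{f^\pm}-\hat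 Z^{f^\mp})\hat w^{\pm}}{\hat Z^{f^+}+\hat Z^{f^-}}$. (b) Nonlinear interface: $\hat{\mathcal{Q}}^{f^\pm}$ are functions such that, for all $\hat w^\pm$, the quantities $v^\pm=\dfrac{\hat{\mathcal{Q}}^{f^\pm}+\hat w^\pm}{2\hat Z^{f^\pm}}$ and $s^\pm=\dfrac{\hat{\mathcal{Q}}^{f^\pm}-\hat w^\pm}{2}$ satisfy $s^-=-s^+$ and $s^\pm=\hat F(V^\pm)$ with $V^\pm=v^\mp-v^\pm$, where $\hat F$ (which may depend on the face point) satisfies $V\hat F(V)\ge0$ and $\hat F(-V)=-\hat F(V)$ for all $V$. *)

theory Defs
  imports "HOL-Analysis.Analysis"
begin

datatype side = Minus_Side | Plus_Side

fun opp :: "side \<Rightarrow> side" where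
  "opp Minus_Side = Plus_Side"
| "opp Plus_Side = Minus_Side"

definition positive_diagonal :: "real ^ 'n ^ 'n \<Rightarrow> bool" where
  "positive_diagonal A \<longleftrightarrow> (\<forall>i j. i \<noteq> j \<longrightarrow> A $ i $ j = 0) \<and> (\<forall>i. 0 < A $ i $ i)"

(* The next two predicates concern a single face point: Z s is the scalar impedance on
   side s, and the arguments of Q s are the w of side s itself, then that of the other side. *)

definition computational_interface ::
    "(side \<Rightarrow> real) \<Rightarrow> (side \<Rightarrow> real \<Rightarrow> real \<Rightarrow> real) \<Rightarrow> bool" where
  "computational_interface Z Q \<longleftrightarrow>
     (\<forall>s w w'. Q s w w' =
        (2 * Z s * w' + (Z s - Z (opp s)) * w) / (Z Plus_Side + Z Minus_Side))"

definition nonlinear_interface ::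
    "(side \<Rightarrow> real) \<Rightarrow> (side \<Rightarrow> real \<Rightarrow> real \<Rightarrow> real) \<Rightarrow> bool" where
  "nonlinear_interface Z Q \<longleftrightarrow>
     (\<exists>F :: real \<Rightarrow> real.
        (\<forall>V. 0 \<le> V * F V) \<and> (\<forall>V. F (- V) = - F V) \<and>
        (\<forall>w :: side \<Rightarrow> real.
           let v = (\<lambda>s. (Q s (w s) (w (opp s)) + w s) / (2 * Z s));
               \<sigma> = (\<lambda>s. (Q s (w s) (w (opp s)) - w s) / 2)
           in \<sigma> Minus_Side = - \<sigma> Plus_Side \<and> (\<forall>s. \<sigma> s = F (v (opp s) - v s))))"

end

theory Submission
  imports Defs
begin

text \<open>
  All matrices are diagonal, so everything decouples over the face points. At a face point on one
  side, the characteristic \<open>w = z u - t\<close> running into the interface is the same for the grid data \<open>(u, t)\<close> and for the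
  flux data \<open>(u*, t*)\<close>: the flux keeps \<open>w\<close> and only replaces the characteristic
  \<open>q = z u + t\<close> returning from it by \<open>q*\<close>. The face rate of change is
    \<^emph>\<open>t* u + t (u* - u) = t* u* - (t* - t) (u* - u)\<close>,
  and since \<open>w\<close> is preserved both differences are multiples of \<open>q* - q\<close>, which makes the second
  term the dissipation \<open>(q* - q)\<^sup>2 / (4 z)\<close> (\<open>face_point_energy\<close>).

  Adding the two sides leaves the power of the flux data. Both kinds of interface enter only through
  the same two properties: the flux tractions balance, so this power equals \<open>- t* V*\<close> on the minus
  side, and the traction never opposes the slip velocity \<open>V*\<close> (\<open>computational_interface_passive\<close>,
  \<open>nonlinear_interface_passive\<close>). For a computational interface the slip vanishes; for a nonlinear
  one the second property is \<open>V F(V) \<ge> 0\<close>.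
\<close>

lemma positive_diagonal_mult_vector:
  assumes "positive_diagonal A"
  shows "(A *v x) $ i = A $ i $ i * x $ i"
proof -
  have "(A *v x) $ i = (\<Sum>j\<in>UNIV. if j = i then A $ i $ i * x $ i else 0)"
    unfolding matrix_vector_mult_def vec_lambda_beta
    using assms by (intro sum.cong) (auto simp: positive_diagonal_def)
  then show ?thesis by simp
qed

lemma positive_diagonal_inv_mult_vector:
  assumes A: "positive_diagonal A"
  shows "(matrix_inv A *v x) $ i = x $ i / A $ i $ i"
proof -
  have pos: "A $ j $ j > 0" for j
    using A by (simp add: positive_diagonal_def)
  have "y = 0" if "A *v y = 0" for y
  proof -
    have "A $ j $ j * y $ j = 0" for j
      using that positive_diagonal_mult_vector[OF A, of y j] by simp
    then show "y = 0"
      using pos by (simp add: vec_eq_iff) (metis less_irrefl)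
  qed
  then have "invertible A"
    unfolding invertible_left_inverse matrix_left_invertible_ker by blast
  then have "A ** matrix_inv A = mat 1"
    unfolding invertible_def matrix_inv_def by (rule someI2_ex) blast
  then have "A *v (matrix_inv A *v x) = x"
    by (simp add: matrix_vector_mul_assoc)
  then have "A $ i $ i * (matrix_inv A *v x) $ i = x $ i"
    using positive_diagonal_mult_vector[OF A, of "matrix_inv A *v x" i] by simp
  then show ?thesis
    using pos[of i] by (simp add: field_simps)
qed

text \<open>
  Both data satisfy \<open>z u - t = w\<close>, hence \<open>t* - t = (q* - q) / 2\<close> and
  \<open>u* - u = (q* - q) / (2 z)\<close>; the dissipation is the product of these jumps.
\<close>

lemma face_point_energy:
  fixes z u t q' :: real
  assumes "z > 0"
  defines "w \<equiv> z * u - t"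
  defines "u' \<equiv> (q' + w) / (2 * z)" and "t' \<equiv> (q' - w) / 2"
  shows "t' * u + t * (u' - u) = t' * u' - (q' - (z * u + t))\<^sup>2 / (4 * z)"
proof -
  have "t' - t = (q' - (z * u + t)) / 2"
    unfolding t'_def w_def by (simp add: field_simps)
  moreover have "u' - u = (q' - (z * u + t)) / (2 * z)"
    unfolding u'_def w_def using \<open>z > 0\<close> by (simp add: field_simps)
  ultimately have "(t' - t) * (u' - u) = (q' - (z * u + t))\<^sup>2 / (4 * z)"
    by (simp only: power2_eq_square times_divide_times_eq)
  then show ?thesis
    by (simp add: algebra_simps)
qed

text \<open>
  The two flux velocities coincide, both being \<open>(w\<^sup>+ + w\<^sup>-) / (Z\<^sup>+ + Z\<^sup>-)\<close>: the blocks are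
  welded together and no power is lost across the interface.
\<close>

lemma computational_interface_passive:
  fixes w :: "side \<Rightarrow> real"
  assumes Q: "computational_interface Z Q" and Z: "\<And>s. Z s > 0"
  defines "v \<equiv> \<lambda>s. (Q s (w s) (w (opp s)) + w s) / (2 * Z s)"
  defines "\<sigma> \<equiv> \<lambda>s. (Q s (w s) (w (opp s)) - w s) / 2"
  shows "\<sigma> Plus_Side = - \<sigma> Minus_Side"
    and "\<sigma> Minus_Side * (v Plus_Side - v Minus_Side) \<ge> 0"
proof -
  have pos: "Z Plus_Side > 0" "Z Minus_Side > 0" "Z Plus_Side + Z Minus_Side > 0"
    using Z by (auto intro: add_pos_pos)
  note Q_eq = Q[unfolded computational_interface_def, rule_format]
  show "\<sigma> Plus_Side = - \<sigma> Minus_Side"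
    unfolding \<sigma>_def Q_eq using pos by (simp add: divide_simps) (simp add: algebra_simps)
  have "v Plus_Side = (w Plus_Side + w Minus_Side) / (Z Plus_Side + Z Minus_Side)"
    unfolding v_def Q_eq using pos by (simp add: divide_simps) (simp add: algebra_simps)
  moreover have "v Minus_Side = (w Plus_Side + w Minus_Side) / (Z Plus_Side + Z Minus_Side)"
    unfolding v_def Q_eq using pos by (simp add: divide_simps) (simp add: algebra_simps)
  ultimately show "\<sigma> Minus_Side * (v Plus_Side - v Minus_Side) \<ge> 0"
    by simp
qed

lemma nonlinear_interface_passive:
  fixes w :: "side \<Rightarrow> real"
  assumes Q: "nonlinear_interface Z Q"
  defines "v \<equiv> \<lambda>s. (Q s (w s) (w (opp s)) + w s) / (2 * Z s)"
  defines "\<sigma> \<equiv> \<lambda>s. (Q s (w s) (w (opp s)) - w s) / 2"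
  shows "\<sigma> Plus_Side = - \<sigma> Minus_Side"
    and "\<sigma> Minus_Side * (v Plus_Side - v Minus_Side) \<ge> 0"
proof -
  obtain F where F: "\<forall>V. 0 \<le> V * F V"
    and \<sigma>: "\<sigma> Minus_Side = - \<sigma> Plus_Side" "\<And>s. \<sigma> s = F (v (opp s) - v s)"
    using Q unfolding nonlinear_interface_def Let_def v_def \<sigma>_def by blast
  show "\<sigma> Plus_Side = - \<sigma> Minus_Side"
    using \<sigma>(1) by simp
  show "\<sigma> Minus_Side * (v Plus_Side - v Minus_Side) \<ge> 0"
    using F \<sigma>(2)[of Minus_Side] by (simp add: mult.commute)
qed

theorem mainTheorem6:
  fixes H :: "real ^ 'n ^ 'n"
    and Z :: "side \<Rightarrow> real ^ 'n ^ 'n"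
    and Q :: "'n \<Rightarrow> side \<Rightarrow> real \<Rightarrow> real \<Rightarrow> real"
    and udot \<tau> wstar qstar udotstar \<tau>star Vstar q :: "side \<Rightarrow> real ^ 'n"
    and Edot :: "side \<Rightarrow> real"
  assumes H: "positive_diagonal H"
    and Z: "\<And>s. positive_diagonal (Z s)"
    and Q: "(\<forall>i. computational_interface (\<lambda>s. Z s $ i $ i) (Q i))
            \<or> (\<forall>i. nonlinear_interface (\<lambda>s. Z s $ i $ i) (Q i))"
    and wstar: "\<And>s. wstar s = Z s *v udot s - \<tau> s"
    and qstar: "\<And>s. qstar s = (\<chi> i. Q i s (wstar s $ i) (wstar (opp s) $ i))"
    and udotstar: "\<And>s. udotstar s = (1 / 2) *\<^sub>R (matrix_inv (Z s) *v (qstar s + wstar s))"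
    and \<tau>star: "\<And>s. \<tau>star s = (1 / 2) *\<^sub>R (qstar s - wstar s)"
    and Edot: "\<And>s. Edot s = \<tau>star s \<bullet> (H *v udot s) + \<tau> s \<bullet> (H *v (udotstar s - udot s))"
    and Vstar: "\<And>s. Vstar s = udotstar (opp s) - udotstar s"
    and q: "\<And>s. q s = Z s *v udot s + \<tau> s"
  shows "Edot Minus_Side + Edot Plus_Side =
           - (\<tau>star Minus_Side \<bullet> (H *v Vstar Minus_Side))
           - (1 / 4) * (\<Sum>s\<in>{Minus_Side, Plus_Side}.
               (qstar s - q s) \<bullet> ((matrix_inv (Z s) ** H) *v (qstar s - q s)))
         \<and> Edot Minus_Side + Edot Plus_Side \<le> 0"
proof -
  define h where "h i = H $ i $ i" for i
  define z where "z s i = Z s $ i $ i" for s i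
  have h_pos: "h i > 0" for i
    using H by (simp add: positive_diagonal_def h_def)
  have z_pos: "z s i > 0" for s i
    using Z by (simp add: positive_diagonal_def z_def)
  have H_nth: "(H *v x) $ i = h i * x $ i" for x i
    unfolding h_def by (rule positive_diagonal_mult_vector[OF H])
  have Z_nth: "(Z s *v x) $ i = z s i * x $ i" for s x i
    unfolding z_def by (rule positive_diagonal_mult_vector[OF Z])
  have Zinv_nth: "(matrix_inv (Z s) *v x) $ i = x $ i / z s i" for s x i
    unfolding z_def by (rule positive_diagonal_inv_mult_vector[OF Z])

  define power where "power s i = \<tau>star s $ i * udotstar s $ i" for s i
  define diss where "diss s i = (qstar s $ i - q s $ i)\<^sup>2 / z s i" for s i

  have \<tau>star_nth: "\<tau>star s $ i = (qstar s $ i - wstar s $ i) / 2" for s i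
    by (simp add: \<tau>star)
  have udotstar_nth: "udotstar s $ i = (qstar s $ i + wstar s $ i) / (2 * z s i)" for s i
    by (simp add: udotstar Zinv_nth)
  have wstar_nth: "wstar s $ i = z s i * udot s $ i - \<tau> s $ i" for s i
    by (simp add: wstar Z_nth)
  have q_nth: "q s $ i = z s i * udot s $ i + \<tau> s $ i" for s i
    by (simp add: q Z_nth)

  have energy_nth: "\<tau>star s $ i * udot s $ i + \<tau> s $ i * (udotstar s $ i - udot s $ i)
      = power s i - diss s i / 4" for s i
    using face_point_energy[OF z_pos[of s i], where q' = "qstar s $ i"]
    by (simp add: power_def diss_def \<tau>star_nth udotstar_nth wstar_nth q_nth)

  have Edot_sum: "Edot s = (\<Sum>i\<in>UNIV. h i * power s i) - (\<Sum>i\<in>UNIV. h i * diss s i) / 4" for s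
  proof -
    have "Edot s = (\<Sum>i\<in>UNIV. h i * (\<tau>star s $ i * udot s $ i
        + \<tau> s $ i * (udotstar s $ i - udot s $ i)))"
      by (simp add: Edot inner_vec_def H_nth sum.distrib[symmetric] algebra_simps)
    then show ?thesis
      unfolding energy_nth by (simp add: right_diff_distrib sum_subtractf sum_divide_distrib)
  qed

  have diss_form: "(qstar s - q s) \<bullet> ((matrix_inv (Z s) ** H) *v (qstar s - q s))
      = (\<Sum>i\<in>UNIV. h i * diss s i)" for s
    by (simp add: inner_vec_def matrix_vector_mul_assoc[symmetric] Zinv_nth H_nth diss_def
        power2_eq_square mult_ac)

  have interface:
    "\<tau>star Plus_Side $ i = - \<tau>star Minus_Side $ i"
    "\<tau>star Minus_Side $ i * (udotstar Plus_Side $ i - udotstar Minus_Side $ i) \<ge> 0" for i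
  proof -
    have qstar_nth: "qstar s $ i = Q i s (wstar s $ i) (wstar (opp s) $ i)" for s
      by (simp add: qstar)
    note \<tau>_eq = \<tau>star_nth[of _ i, unfolded qstar_nth]
    note u_eq = udotstar_nth[of _ i, unfolded qstar_nth]
    consider "computational_interface (\<lambda>s. z s i) (Q i)" | "nonlinear_interface (\<lambda>s. z s i) (Q i)"
      using Q unfolding z_def by blast
    then have "\<tau>star Plus_Side $ i = - \<tau>star Minus_Side $ i \<and>
        \<tau>star Minus_Side $ i * (udotstar Plus_Side $ i - udotstar Minus_Side $ i) \<ge> 0"
    proof cases
      case 1
      show ?thesis
        unfolding \<tau>_eq u_eq
        using computational_interface_passive[OF 1 z_pos, of "\<lambda>s. wstar s $ i"] by blast
    next
      case 2
      show ?thesis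
        unfolding \<tau>_eq u_eq
        using nonlinear_interface_passive[OF 2, of "\<lambda>s. wstar s $ i"] by blast
    qed
    then show "\<tau>star Plus_Side $ i = - \<tau>star Minus_Side $ i"
      "\<tau>star Minus_Side $ i * (udotstar Plus_Side $ i - udotstar Minus_Side $ i) \<ge> 0"
      by blast+
  qed

  have slip_form: "\<tau>star Minus_Side \<bullet> (H *v Vstar Minus_Side) = (\<Sum>i\<in>UNIV. h i *
      (\<tau>star Minus_Side $ i * (udotstar Plus_Side $ i - udotstar Minus_Side $ i)))"
    by (simp add: inner_vec_def H_nth Vstar mult_ac)
  also have "\<dots> = - (\<Sum>i\<in>UNIV. h i * power Minus_Side i) - (\<Sum>i\<in>UNIV. h i * power Plus_Side i)"
    by (simp add: power_def interface(1) sum_negf[symmetric] sum_subtractf[symmetric] algebra_simps)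
  finally have slip_power: "\<tau>star Minus_Side \<bullet> (H *v Vstar Minus_Side)
      = - (\<Sum>i\<in>UNIV. h i * power Minus_Side i) - (\<Sum>i\<in>UNIV. h i * power Plus_Side i)" .

  have identity: "Edot Minus_Side + Edot Plus_Side =
           - (\<tau>star Minus_Side \<bullet> (H *v Vstar Minus_Side))
           - (1 / 4) * (\<Sum>s\<in>{Minus_Side, Plus_Side}.
               (qstar s - q s) \<bullet> ((matrix_inv (Z s) ** H) *v (qstar s - q s)))"
    by (simp add: Edot_sum diss_form slip_power field_simps)
  have "\<tau>star Minus_Side \<bullet> (H *v Vstar Minus_Side) \<ge> 0"
    unfolding slip_form using h_pos interface(2)
    by (simp add: sum_nonneg less_imp_le)
  moreover have "(\<Sum>i\<in>UNIV. h i * diss s i) \<ge> 0" for s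
    unfolding diss_def using h_pos z_pos
    by (intro sum_nonneg mult_nonneg_nonneg divide_nonneg_nonneg) (auto intro: less_imp_le)
  then have "(\<Sum>s\<in>{Minus_Side, Plus_Side}.
      (qstar s - q s) \<bullet> ((matrix_inv (Z s) ** H) *v (qstar s - q s))) \<ge> 0"
    by (simp add: diss_form)
  ultimately show ?thesis
    using identity by linarith
qed

end
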